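(* Let $Q_R$ be a projection onto a $(P^{-1}A)$-invariant subspace $\mathbf{Z}$, let $\mathcal{N}_T=Q_R+P^{-1}A(\mathrm{Id}-Q_R)$, let $\delta\mathcal{N}\in\mathcal{M}_n(\mathbb{C})$ be a perturbation and $\mathcal{N}=\mathcal{N}_T+\delta\mathcal{N}$. Suppose $\mathcal{N}_T$ is diagonalizable and let $V$ be a matrix of eigenvectors of $\mathcal{N}_T$. Let $\lambda$ be the spectral radius of $\mathrm{Id}-\mathcal{N}_T$ and suppose that $\lambda<1-\delta$ with $\delta>0$. If $\delta>\kappa_p(V)\|\delta\mathcal{N}\|_p$, then the iterations associated to $\mathcal{N}$, $$x^{(k+1)}=x^{(k)}+\mathcal{N}(x^\infty-x^{(k)}),$$ converge, and the spectral radius governing the convergence rate, $\rho(\mathrm{Id}-\mathcal{N})$, is smaller than $1-\delta+\kappa_p(V)\|\delta\mathcal{N}\|_p$.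
   Context: $A,P\in GL_n(\mathbb{R})$, $b\in\mathbb{R}^n$, and $x^\infty$ is the solution of $Ax^\infty=b$; $\mathcal{M}_n(\mathbb{C})$ denotes the complex $n\times n$ matrices. All matrices are written in a basis adapted to the decomposition $\mathrm{Im}(Q_R)\oplus\ker(Q_R)$, in which $\mathcal{N}_T$ is block upper triangular. The situation modelled is the one where the space actually used is a slight perturbation of the invariant space $\mathbf{Z}$ spanned by eigenvectors of $P^{-1}A$; $\mathcal{N}$ is the resulting deflated matrix. For an invertible matrix $X$, $\kappa_p(X)=\|X\|_p\|X^{-1}\|_p$ is the condition number for the matrix $p$-norm $\|\cdot\|_p$ (the operator norm induced by the vector $p$-norm). *)

theory Defs
  imports
    "HOL-Library.Extended_Real"
    "Jordan_Normal_Form.Gauss_Jordan_Elimination"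
    "Jordan_Normal_Form.VS_Connect"
    "Jordan_Normal_Form.Spectral_Radius"
begin

(* The inverse of an invertible square matrix; unspecified for all other matrices. *)
definition inv_mat :: "'a :: field mat \<Rightarrow> 'a mat" where
  "inv_mat A = the (mat_inverse A)"

(* The matrix, with respect to the basis formed by the columns of B, of the endomorphism whose
   matrix in the canonical basis is M; likewise for the coordinates of a vector.
   The basis matters because matrix p-norms are not invariant under a change of basis. *)
definition mat_in_basis :: "'a :: field mat \<Rightarrow> 'a mat \<Rightarrow> 'a mat" where
  "mat_in_basis B M = inv_mat B * M * B"

definition vec_in_basis :: "'a :: field mat \<Rightarrow> 'a vec \<Rightarrow> 'a vec" where
  "vec_in_basis B v = inv_mat B *\<^sub>v v"

definition invariant_subspace :: "nat \<Rightarrow> complex mat \<Rightarrow> complex vec set \<Rightarrow> bool" where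
  "invariant_subspace n M Z \<longleftrightarrow>
     subspace class_ring Z (module_vec TYPE(complex) n) \<and> (\<forall>z\<in>Z. M *\<^sub>v z \<in> Z)"

definition projection_onto :: "nat \<Rightarrow> complex mat \<Rightarrow> complex vec set \<Rightarrow> bool" where
  "projection_onto n Q Z \<longleftrightarrow>
     Q \<in> carrier_mat n n \<and> Q * Q = Q \<and> (\<lambda>v. Q *\<^sub>v v) ` carrier_vec n = Z"

definition diagonalizable_mat :: "'a :: comm_ring_1 mat \<Rightarrow> bool" where
  "diagonalizable_mat M \<longleftrightarrow> (\<exists>D. diagonal_mat D \<and> similar_mat M D)"

(* The columns of V form a basis of the whole space consisting of eigenvectors of M. *)
definition eigenvector_matrix :: "'a :: comm_ring_1 mat \<Rightarrow> 'a mat \<Rightarrow> bool" where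
  "eigenvector_matrix M V \<longleftrightarrow>
     V \<in> carrier_mat (dim_row M) (dim_row M) \<and> invertible_mat V \<and>
     (\<forall>j<dim_row M. \<exists>\<mu>. eigenvector M (col V j) \<mu>)"

(* Meant for 1 \<le> p \<le> \<infinity> and vectors of positive dimension. *)
definition vec_pnorm :: "ereal \<Rightarrow> complex vec \<Rightarrow> real" where
  "vec_pnorm p v =
     (if p = \<infinity> then Max ((\<lambda>i. cmod (v $ i)) ` {..<dim_vec v})
      else (\<Sum>i<dim_vec v. cmod (v $ i) powr real_of_ereal p) powr (1 / real_of_ereal p))"

definition mat_pnorm :: "ereal \<Rightarrow> complex mat \<Rightarrow> real" where
  "mat_pnorm p M =
     (SUP v \<in> {v \<in> carrier_vec (dim_col M). v \<noteq> 0\<^sub>v (dim_col M)}.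
        vec_pnorm p (M *\<^sub>v v) / vec_pnorm p v)"

definition cond_number :: "ereal \<Rightarrow> complex mat \<Rightarrow> real" where
  "cond_number p X = mat_pnorm p X * mat_pnorm p (inv_mat X)"

(* The type of vectors of all dimensions carries no topology, so convergence in the
   n-dimensional space is expressed through the entries. *)
definition vec_tendsto :: "nat \<Rightarrow> (nat \<Rightarrow> complex vec) \<Rightarrow> complex vec \<Rightarrow> bool" where
  "vec_tendsto n x l \<longleftrightarrow>
     (\<forall>k. x k \<in> carrier_vec n) \<and> l \<in> carrier_vec n \<and> (\<forall>i<n. (\<lambda>k. x k $ i) \<longlonglongrightarrow> l $ i)"

end

theory Submission
  imports Defs
begin

text \<open>
  The estimate is the Bauer--Fike theorem. If \<open>M V = V D\<close> with \<open>D\<close> diagonal and \<open>v = V w\<close> is an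
  eigenvector of \<open>M + E\<close> for \<open>\<mu>\<close>, then \<open>\<mu> w - D w = V\<^sup>-\<^sup>1 E V w\<close>. The entries of the left-hand
  side are the entries of \<open>w\<close> multiplied by the numbers \<open>\<mu> - \<nu>\<close> with \<open>\<nu>\<close> an eigenvalue of \<open>M\<close>,
  and a vector \<open>p\<close>-norm is monotone in the moduli of the entries, so its norm is at least
  \<open>min \<bar>\<mu> - \<nu>\<bar> \<cdot> \<parallel>w\<parallel>\<close>; that of the right-hand side is at most \<open>\<kappa>\<^sub>p(V) \<parallel>E\<parallel>\<^sub>p \<parallel>w\<parallel>\<close>. Hence every
  eigenvalue of the perturbed matrix lies within \<open>\<kappa>\<^sub>p(V) \<parallel>E\<parallel>\<^sub>p\<close> of an eigenvalue of \<open>M\<close>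
  (lemma \<open>bauer_fike\<close>).

  Taking \<open>M = N\<^sub>T\<close> and passing to the eigenvalues \<open>1 - \<mu>\<close> of \<open>Id - N\<close>, one gets
  \<open>\<rho>(Id - N) \<le> \<lambda> + \<kappa>\<^sub>p(V) \<parallel>\<delta>N\<parallel>\<^sub>p < 1 - \<delta> + \<kappa>\<^sub>p(V) \<parallel>\<delta>N\<parallel>\<^sub>p < 1\<close>. The error of the iteration is
  multiplied by \<open>Id - N\<close> in each step, and the powers of a matrix of spectral radius below \<open>1\<close>
  tend to \<open>0\<close> (lemma \<open>pow_mat_tendsto_0\<close>), whence convergence.
\<close>

section \<open>Inverse matrices and eigenvalues\<close>

lemma inv_mat_inverse:
  assumes A: "A \<in> carrier_mat n n" and inv: "invertible_mat A"
  shows "inv_mat A \<in> carrier_mat n n" "A * inv_mat A = 1\<^sub>m n" "inv_mat A * A = 1\<^sub>m n"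
proof -
  from inv obtain C where "inverts_mat A C" "inverts_mat C A"
    unfolding invertible_mat_def by blast
  hence AC: "A * C = 1\<^sub>m n" and CA: "C * A = 1\<^sub>m (dim_row C)"
    using A unfolding inverts_mat_def by auto
  have "dim_row C = n" using arg_cong[OF CA, of dim_col] A by simp
  moreover have "dim_col C = n" using arg_cong[OF AC, of dim_col] by simp
  ultimately have C: "C \<in> carrier_mat n n" by auto
  have "A \<in> Units (ring_mat TYPE('a) n undefined)"
    unfolding Units_def ring_mat_def using A C AC CA by auto
  then obtain D where D: "mat_inverse A = Some D"
    using mat_inverse(1)[OF A, of undefined] by (cases "mat_inverse A") auto
  have "inv_mat A = D" unfolding inv_mat_def D by simp
  thus "inv_mat A \<in> carrier_mat n n" "A * inv_mat A = 1\<^sub>m n" "inv_mat A * A = 1\<^sub>m n"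
    using mat_inverse(2)[OF A D] by auto
qed

lemma eigenvalue_one_minus_iff:
  fixes M :: "'a :: comm_ring_1 mat"
  assumes M: "M \<in> carrier_mat n n"
  shows "eigenvalue (1\<^sub>m n - M) (1 - \<mu>) \<longleftrightarrow> eigenvalue M \<mu>"
proof -
  have "(1\<^sub>m n - M) *\<^sub>v v = (1 - \<mu>) \<cdot>\<^sub>v v \<longleftrightarrow> M *\<^sub>v v = \<mu> \<cdot>\<^sub>v v" if v: "v \<in> carrier_vec n" for v
  proof -
    have "(1\<^sub>m n - M) *\<^sub>v v = v - M *\<^sub>v v"
      using minus_mult_distrib_mat_vec[OF one_carrier_mat M v] v by simp
    hence "(1\<^sub>m n - M) *\<^sub>v v = (1 - \<mu>) \<cdot>\<^sub>v v
        \<longleftrightarrow> (\<forall>i<n. v $ i - (M *\<^sub>v v) $ i = (1 - \<mu>) * v $ i)"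
      using v M by (simp add: vec_eq_iff del: index_mult_mat_vec)
    also have "\<dots> \<longleftrightarrow> (\<forall>i<n. (M *\<^sub>v v) $ i = \<mu> * v $ i)"
      by (simp add: left_diff_distrib del: index_mult_mat_vec)
    also have "\<dots> \<longleftrightarrow> M *\<^sub>v v = \<mu> \<cdot>\<^sub>v v"
      using v M by (simp add: vec_eq_iff del: index_mult_mat_vec)
    finally show ?thesis .
  qed
  thus ?thesis using M unfolding eigenvalue_def eigenvector_def by auto
qed

lemma cmod_eigenvalue_le_spectral_radius:
  assumes A: "A \<in> carrier_mat n n" and ev: "eigenvalue A \<mu>"
  shows "cmod \<mu> \<le> spectral_radius A"
  using spectral_radius_mem_max(2)[OF A eigenvalue_imp_nonzero_dim[OF A ev]] ev
  unfolding spectrum_def by auto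

lemma spectral_radius_attained:
  assumes A: "A \<in> carrier_mat n n" and n: "0 < n"
  obtains \<mu> where "eigenvalue A \<mu>" "spectral_radius A = cmod \<mu>"
  using spectral_radius_mem_max(1)[OF A n] unfolding spectrum_def by auto

section \<open>Vector and matrix p-norms\<close>

lemma pnorm_exponent_cases:
  assumes "(1 :: ereal) \<le> p"
  obtains "p = \<infinity>" | q where "p = ereal q" "1 \<le> q"
  using assms by (cases p) auto

lemma vec_pnorm_mono:
  assumes p: "1 \<le> p" and dim: "dim_vec v = dim_vec w" "0 < dim_vec w"
    and le: "\<And>i. i < dim_vec w \<Longrightarrow> cmod (v $ i) \<le> cmod (w $ i)"
  shows "vec_pnorm p v \<le> vec_pnorm p w"
using p
proof (cases rule: pnorm_exponent_cases)
  case 1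
  have "Max ((\<lambda>i. cmod (v $ i)) ` {..<dim_vec v}) \<le> Max ((\<lambda>i. cmod (w $ i)) ` {..<dim_vec w})"
  proof (rule Max.boundedI)
    fix a assume "a \<in> (\<lambda>i. cmod (v $ i)) ` {..<dim_vec v}"
    then obtain i where i: "i < dim_vec w" "a = cmod (v $ i)" using dim by auto
    have "cmod (w $ i) \<le> Max ((\<lambda>i. cmod (w $ i)) ` {..<dim_vec w})"
      by (rule Max_ge) (use i in auto)
    thus "a \<le> Max ((\<lambda>i. cmod (w $ i)) ` {..<dim_vec w})" using order_trans[OF le[OF i(1)]] i(2) by blast
  qed (use dim in auto)
  thus ?thesis unfolding vec_pnorm_def using 1 by simp
next
  case (2 q)
  have "(\<Sum>i<dim_vec v. cmod (v $ i) powr q) \<le> (\<Sum>i<dim_vec w. cmod (w $ i) powr q)"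
    unfolding dim by (intro sum_mono powr_mono2) (use le 2 in auto)
  hence "(\<Sum>i<dim_vec v. cmod (v $ i) powr q) powr (1 / q)
       \<le> (\<Sum>i<dim_vec w. cmod (w $ i) powr q) powr (1 / q)"
    by (intro powr_mono2 sum_nonneg) (use 2 in auto)
  thus ?thesis unfolding vec_pnorm_def using 2 by simp
qed

lemma vec_pnorm_smult:
  assumes p: "1 \<le> p" and dim: "0 < dim_vec v"
  shows "vec_pnorm p (c \<cdot>\<^sub>v v) = cmod c * vec_pnorm p v"
using p
proof (cases rule: pnorm_exponent_cases)
  case 1
  have "mono ((*) (cmod c))" by (auto intro!: monoI mult_left_mono)
  hence "cmod c * Max ((\<lambda>i. cmod (v $ i)) ` {..<dim_vec v})
      = Max ((*) (cmod c) ` (\<lambda>i. cmod (v $ i)) ` {..<dim_vec v})"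
    by (rule mono_Max_commute) (use dim in auto)
  also have "(*) (cmod c) ` (\<lambda>i. cmod (v $ i)) ` {..<dim_vec v}
      = (\<lambda>i. cmod ((c \<cdot>\<^sub>v v) $ i)) ` {..<dim_vec v}"
    by (auto simp: image_image norm_mult intro!: image_cong)
  finally show ?thesis unfolding vec_pnorm_def using 1 by simp
next
  case (2 q)
  have "(\<Sum>i<dim_vec v. cmod ((c \<cdot>\<^sub>v v) $ i) powr q)
      = cmod c powr q * (\<Sum>i<dim_vec v. cmod (v $ i) powr q)"
    by (simp add: sum_distrib_left norm_mult powr_mult)
  hence "(\<Sum>i<dim_vec v. cmod ((c \<cdot>\<^sub>v v) $ i) powr q) powr (1 / q)
      = cmod c * (\<Sum>i<dim_vec v. cmod (v $ i) powr q) powr (1 / q)"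
    using 2 by (simp add: powr_mult powr_powr sum_nonneg)
  thus ?thesis unfolding vec_pnorm_def using 2 by simp
qed

lemma cmod_index_le_vec_pnorm:
  assumes p: "1 \<le> p" and i: "i < dim_vec v"
  shows "cmod (v $ i) \<le> vec_pnorm p v"
using p
proof (cases rule: pnorm_exponent_cases)
  case 1
  thus ?thesis unfolding vec_pnorm_def using i by (auto intro!: Max_ge)
next
  case (2 q)
  have "cmod (v $ i) powr q \<le> (\<Sum>i<dim_vec v. cmod (v $ i) powr q)"
    by (rule member_le_sum) (use i in auto)
  hence "(cmod (v $ i) powr q) powr (1 / q) \<le> (\<Sum>i<dim_vec v. cmod (v $ i) powr q) powr (1 / q)"
    by (intro powr_mono2) (use 2 in auto)
  thus ?thesis unfolding vec_pnorm_def using 2 by (simp add: powr_powr)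
qed

lemma vec_pnorm_nonneg:
  assumes "1 \<le> p" "0 < dim_vec v"
  shows "0 \<le> vec_pnorm p v"
  using cmod_index_le_vec_pnorm[OF assms] norm_ge_zero order_trans by blast

lemma vec_pnorm_pos:
  assumes p: "1 \<le> p" and v: "v \<in> carrier_vec n" "v \<noteq> 0\<^sub>v n"
  shows "0 < vec_pnorm p v"
proof -
  from v obtain i where i: "i < dim_vec v" "v $ i \<noteq> 0" by (auto simp: vec_eq_iff)
  hence "0 < cmod (v $ i)" by simp
  thus ?thesis using cmod_index_le_vec_pnorm[OF p i(1)] by linarith
qed

text \<open>
  The factor \<open>dim_vec v\<close> dominates the optimal \<open>(dim_vec v) powr (1/p)\<close> for every \<open>p\<close> at once, and
  any constant suffices for showing that operator norms are finite.
\<close>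

lemma vec_pnorm_le_dim_times_bound:
  assumes p: "1 \<le> p" and dim: "0 < dim_vec v"
    and le: "\<And>i. i < dim_vec v \<Longrightarrow> cmod (v $ i) \<le> m"
  shows "vec_pnorm p v \<le> real (dim_vec v) * m"
proof -
  have m0: "0 \<le> m" using le[OF dim] norm_ge_zero order_trans by blast
  have dim1: "1 \<le> real (dim_vec v)" using dim by simp
  show ?thesis
    using p
  proof (cases rule: pnorm_exponent_cases)
    case 1
    have "Max ((\<lambda>i. cmod (v $ i)) ` {..<dim_vec v}) \<le> m"
      by (rule Max.boundedI) (use dim le in auto)
    also have "m \<le> real (dim_vec v) * m" using mult_right_mono[OF dim1 m0] by simp
    finally show ?thesis unfolding vec_pnorm_def using 1 by simp
  next
    case (2 q)
    have "(\<Sum>i<dim_vec v. cmod (v $ i) powr q) \<le> (\<Sum>i<dim_vec v. m powr q)"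
      by (intro sum_mono powr_mono2) (use le 2 in auto)
    hence "(\<Sum>i<dim_vec v. cmod (v $ i) powr q) powr (1 / q)
        \<le> (real (dim_vec v) * m powr q) powr (1 / q)"
      by (intro powr_mono2 sum_nonneg) (use 2 in auto)
    also have "\<dots> = real (dim_vec v) powr (1 / q) * m"
      using 2 m0 by (simp add: powr_mult powr_powr)
    also have "\<dots> \<le> real (dim_vec v) powr 1 * m"
      by (intro mult_right_mono powr_mono) (use 2 dim1 m0 in auto)
    finally show ?thesis unfolding vec_pnorm_def using 2 by simp
  qed
qed

text \<open>
  \<open>mat_pnorm\<close> is a supremum of real numbers, so it means something only once the quotients
  are known to be bounded.
\<close>

lemma bdd_above_pnorm_quotients:
  assumes p: "1 \<le> p" and n: "0 < n" and M: "M \<in> carrier_mat n n"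
  shows "bdd_above ((\<lambda>v. vec_pnorm p (M *\<^sub>v v) / vec_pnorm p v)
           ` {v \<in> carrier_vec (dim_col M). v \<noteq> 0\<^sub>v (dim_col M)})"
proof (rule bdd_aboveI2)
  define S where "S = (\<Sum>i<n. \<Sum>j<n. cmod (M $$ (i, j)))"
  fix v :: "complex vec"
  assume "v \<in> {v \<in> carrier_vec (dim_col M). v \<noteq> 0\<^sub>v (dim_col M)}"
  hence v: "v \<in> carrier_vec n" "v \<noteq> 0\<^sub>v n" using M by auto
  have pos: "0 < vec_pnorm p v" by (rule vec_pnorm_pos[OF p v])
  have "cmod ((M *\<^sub>v v) $ i) \<le> S * vec_pnorm p v" if i: "i < n" for i
  proof -
    have "(M *\<^sub>v v) $ i = (\<Sum>j<n. M $$ (i, j) * v $ j)"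
      using M v i by (simp add: scalar_prod_def atLeast0LessThan)
    also have "cmod \<dots> \<le> (\<Sum>j<n. cmod (M $$ (i, j)) * vec_pnorm p v)"
      by (rule sum_norm_le)
        (use v in \<open>auto simp: norm_mult intro!: mult_left_mono cmod_index_le_vec_pnorm[OF p]\<close>)
    also have "\<dots> = (\<Sum>j<n. cmod (M $$ (i, j))) * vec_pnorm p v"
      by (simp add: sum_distrib_right)
    also have "\<dots> \<le> S * vec_pnorm p v"
      unfolding S_def using i pos
      by (intro mult_right_mono member_le_sum[of i "{..<n}" "\<lambda>i. \<Sum>j<n. cmod (M $$ (i, j))"])
        (auto intro: sum_nonneg)
    finally show ?thesis .
  qed
  hence "vec_pnorm p (M *\<^sub>v v) \<le> real (dim_vec (M *\<^sub>v v)) * (S * vec_pnorm p v)"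
    by (intro vec_pnorm_le_dim_times_bound[OF p]) (use M n in auto)
  thus "vec_pnorm p (M *\<^sub>v v) / vec_pnorm p v \<le> real n * S"
    using pos M by (simp add: divide_le_eq mult.assoc)
qed

lemma vec_pnorm_mult_mat_vec_le:
  assumes p: "1 \<le> p" and n: "0 < n" and M: "M \<in> carrier_mat n n" and v: "v \<in> carrier_vec n"
  shows "vec_pnorm p (M *\<^sub>v v) \<le> mat_pnorm p M * vec_pnorm p v"
proof (cases "v = 0\<^sub>v n")
  case True
  have zero: "0\<^sub>v n = (0 :: complex) \<cdot>\<^sub>v 0\<^sub>v n" by (intro eq_vecI) auto
  have "vec_pnorm p (0\<^sub>v n) = 0"
    by (subst zero, subst vec_pnorm_smult[OF p]) (use n in auto)
  moreover have "M *\<^sub>v 0\<^sub>v n = 0\<^sub>v n" using M by (intro eq_vecI) auto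
  ultimately show ?thesis unfolding True by simp
next
  case False
  have "vec_pnorm p (M *\<^sub>v v) / vec_pnorm p v \<le> mat_pnorm p M"
    unfolding mat_pnorm_def
    by (rule cSUP_upper[OF _ bdd_above_pnorm_quotients[OF p n M]]) (use False v M in auto)
  thus ?thesis using vec_pnorm_pos[OF p v False] by (simp add: divide_le_eq)
qed

lemma mat_pnorm_nonneg:
  assumes p: "1 \<le> p" and n: "0 < n" and M: "M \<in> carrier_mat n n"
  shows "0 \<le> mat_pnorm p M"
proof -
  define u :: "complex vec" where "u = unit_vec n 0"
  have u: "u \<in> carrier_vec n" "u \<noteq> 0\<^sub>v n" unfolding u_def using n by auto
  have "0 \<le> vec_pnorm p (M *\<^sub>v u)" by (rule vec_pnorm_nonneg[OF p]) (use M n in auto)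
  also have "\<dots> \<le> mat_pnorm p M * vec_pnorm p u" by (rule vec_pnorm_mult_mat_vec_le[OF p n M u(1)])
  finally show ?thesis using vec_pnorm_pos[OF p u] by (simp add: zero_le_mult_iff)
qed

section \<open>The Bauer--Fike theorem\<close>

lemma mat_diag_mult_vec_index:
  fixes w :: "'a :: semiring_0 vec"
  assumes "w \<in> carrier_vec n" "i < n"
  shows "(mat_diag n f *\<^sub>v w) $ i = f i * w $ i"
proof -
  have "(mat_diag n f *\<^sub>v w) $ i = (\<Sum>j<n. (if i = j then f j else 0) * w $ j)"
    using assms by (simp add: mat_diag_def scalar_prod_def atLeast0LessThan)
  also have "\<dots> = (\<Sum>j<n. if i = j then f j * w $ j else 0)"
    by (intro sum.cong) auto
  finally show ?thesis using assms by simp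
qed

lemma eigenvector_matrix_diagonalizes:
  assumes M: "M \<in> carrier_mat n n" and V: "eigenvector_matrix M V"
  obtains f where "M * V = V * mat_diag n f" "\<And>j. j < n \<Longrightarrow> eigenvalue M (f j)"
proof -
  have Vc: "V \<in> carrier_mat n n" using V M unfolding eigenvector_matrix_def by auto
  have "\<forall>j. \<exists>\<mu>. j < n \<longrightarrow> eigenvector M (col V j) \<mu>"
    using V M unfolding eigenvector_matrix_def by auto
  then obtain f where f: "\<And>j. j < n \<Longrightarrow> eigenvector M (col V j) (f j)" by metis
  have "M * V = V * mat_diag n f"
    unfolding mat_diag_mult_right[OF Vc]
  proof (rule eq_matI)
    fix i j assume "i < dim_row (Matrix.mat n n (\<lambda>(i, j). V $$ (i, j) * f j))"
      "j < dim_col (Matrix.mat n n (\<lambda>(i, j). V $$ (i, j) * f j))"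
    hence ij: "i < n" "j < n" by auto
    have "(M * V) $$ (i, j) = (M *\<^sub>v col V j) $ i" using ij M Vc by simp
    also have "M *\<^sub>v col V j = f j \<cdot>\<^sub>v col V j" using f[OF ij(2)] unfolding eigenvector_def by simp
    finally show "(M * V) $$ (i, j) = Matrix.mat n n (\<lambda>(i, j). V $$ (i, j) * f j) $$ (i, j)"
      using ij Vc by (simp add: mult.commute)
  qed (use M Vc in auto)
  thus ?thesis using that f unfolding eigenvalue_def by blast
qed

text \<open>
  In the coordinates given by the eigenvectors, \<open>M\<close> is diagonal and the perturbation becomes
  \<open>V\<^sup>-\<^sup>1 E V\<close>, whose norm is at most \<open>\<kappa>\<^sub>p(V) \<parallel>E\<parallel>\<^sub>p\<close>; a diagonal matrix shrinks no \<open>p\<close>-norm by more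
  than its entry of least modulus does.
\<close>

lemma bauer_fike:
  assumes p: "1 \<le> p" and M: "M \<in> carrier_mat n n" and E: "E \<in> carrier_mat n n"
    and V: "eigenvector_matrix M V" and ev: "eigenvalue (M + E) \<mu>"
  obtains \<nu> where "eigenvalue M \<nu>" "cmod (\<mu> - \<nu>) \<le> cond_number p V * mat_pnorm p E"
proof -
  have n: "0 < n" using eigenvalue_imp_nonzero_dim[OF _ ev] M E by auto
  have Vc: "V \<in> carrier_mat n n" and Vi: "invertible_mat V"
    using V M unfolding eigenvector_matrix_def by auto
  define W where "W = inv_mat V"
  note W = inv_mat_inverse[OF Vc Vi, folded W_def]
  obtain f where MV: "M * V = V * mat_diag n f" and f: "\<And>j. j < n \<Longrightarrow> eigenvalue M (f j)"
    using eigenvector_matrix_diagonalizes[OF M V] by metis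
  from ev obtain v where v: "v \<in> carrier_vec n" "v \<noteq> 0\<^sub>v n" and Ev: "(M + E) *\<^sub>v v = \<mu> \<cdot>\<^sub>v v"
    unfolding eigenvalue_def eigenvector_def using M E by auto
  define w where "w = W *\<^sub>v v"
  have w: "w \<in> carrier_vec n" unfolding w_def using W v by auto
  have vw: "v = V *\<^sub>v w"
    unfolding w_def using assoc_mult_mat_vec[OF Vc W(1) v(1)] W(2) v(1) by simp
  have w0: "w \<noteq> 0\<^sub>v n" 
  proof
    assume "w = 0\<^sub>v n"
    hence "v = 0\<^sub>v n" unfolding vw using Vc by (intro eq_vecI) auto
    thus False using v(2) by simp
  qed
  define u where "u = W *\<^sub>v (E *\<^sub>v (V *\<^sub>v w))"
  have u: "u \<in> carrier_vec n" unfolding u_def by (rule carrier_vecI) (use W in auto)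

  have "W *\<^sub>v (M *\<^sub>v v) = mat_diag n f *\<^sub>v w"
  proof -
    have "M *\<^sub>v v = (M * V) *\<^sub>v w" unfolding vw using M Vc w by simp
    also have "\<dots> = V *\<^sub>v (mat_diag n f *\<^sub>v w)"
      unfolding MV using assoc_mult_mat_vec[OF Vc mat_diag_dim w] .
    finally have "W *\<^sub>v (M *\<^sub>v v) = (W * V) *\<^sub>v (mat_diag n f *\<^sub>v w)"
      using assoc_mult_mat_vec[OF W(1) Vc mult_mat_vec_carrier[OF mat_diag_dim w]] by simp
    thus ?thesis unfolding W(3) using one_mult_mat_vec[OF mult_mat_vec_carrier[OF mat_diag_dim w]] by simp
  qed
  moreover have "W *\<^sub>v ((M + E) *\<^sub>v v) = W *\<^sub>v (M *\<^sub>v v) + u"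
    unfolding u_def vw[symmetric]
    using add_mult_distrib_mat_vec[OF M E v(1)]
      mult_add_distrib_mat_vec[OF W(1) mult_mat_vec_carrier[OF M v(1)] mult_mat_vec_carrier[OF E v(1)]]
    by simp
  moreover have "W *\<^sub>v ((M + E) *\<^sub>v v) = \<mu> \<cdot>\<^sub>v w"
    unfolding Ev w_def by (rule mult_mat_vec[OF W(1) v(1)])
  ultimately have eq: "\<mu> \<cdot>\<^sub>v w = mat_diag n f *\<^sub>v w + u" by simp
  have ui: "u $ i = (\<mu> - f i) * w $ i" if i: "i < n" for i
    using arg_cong[OF eq, of "\<lambda>x. x $ i"] i w u mat_diag_mult_vec_index[OF w i]
    by (simp add: algebra_simps)

  define m where "m = Min ((\<lambda>i. cmod (\<mu> - f i)) ` {..<n})"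
  have "m \<in> (\<lambda>i. cmod (\<mu> - f i)) ` {..<n}" unfolding m_def by (rule Min_in) (use n in auto)
  then obtain j where j: "j < n" "m = cmod (\<mu> - f j)" by auto
  have "m * vec_pnorm p w = vec_pnorm p (of_real m \<cdot>\<^sub>v w)"
    using vec_pnorm_smult[OF p, of w "of_real m"] w n j(2) by simp
  also have "\<dots> \<le> vec_pnorm p u"
  proof (rule vec_pnorm_mono[OF p])
    fix i assume "i < dim_vec u"
    hence i: "i < n" using u by simp
    have "m \<le> cmod (\<mu> - f i)" unfolding m_def by (rule Min_le) (use i in auto)
    thus "cmod ((of_real m \<cdot>\<^sub>v w) $ i) \<le> cmod (u $ i)"
      using i w j(2) by (simp add: ui norm_mult mult_right_mono)
  qed (use u w n in auto)
  also have "\<dots> \<le> mat_pnorm p W * vec_pnorm p (E *\<^sub>v (V *\<^sub>v w))"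
    unfolding u_def by (intro vec_pnorm_mult_mat_vec_le[OF p n W(1)] carrier_vecI) (use E in auto)
  also have "\<dots> \<le> mat_pnorm p W * (mat_pnorm p E * vec_pnorm p (V *\<^sub>v w))"
    by (intro mult_left_mono mat_pnorm_nonneg[OF p n W(1)] vec_pnorm_mult_mat_vec_le[OF p n E]
        carrier_vecI) (use Vc in auto)
  also have "\<dots> \<le> mat_pnorm p W * (mat_pnorm p E * (mat_pnorm p V * vec_pnorm p w))"
    by (intro mult_left_mono mat_pnorm_nonneg[OF p n] vec_pnorm_mult_mat_vec_le[OF p n Vc] W E w)
  also have "\<dots> = cond_number p V * mat_pnorm p E * vec_pnorm p w"
    unfolding cond_number_def W_def by simp
  finally have "m \<le> cond_number p V * mat_pnorm p E"
    using vec_pnorm_pos[OF p w w0] by simp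
  thus ?thesis using that f j by blast
qed

lemma spectral_radius_one_minus_perturbed_le:
  assumes p: "1 \<le> p" and n: "0 < n" and M: "M \<in> carrier_mat n n" and E: "E \<in> carrier_mat n n"
    and V: "eigenvector_matrix M V"
  shows "spectral_radius (1\<^sub>m n - (M + E))
    \<le> spectral_radius (1\<^sub>m n - M) + cond_number p V * mat_pnorm p E"
proof -
  have c: "1\<^sub>m n - (M + E) \<in> carrier_mat n n" "1\<^sub>m n - M \<in> carrier_mat n n" "M + E \<in> carrier_mat n n"
    using M E by auto
  obtain \<tau> where \<tau>: "eigenvalue (1\<^sub>m n - (M + E)) \<tau>" "spectral_radius (1\<^sub>m n - (M + E)) = cmod \<tau>"
    using spectral_radius_attained[OF c(1) n] .
  have "eigenvalue (M + E) (1 - \<tau>)"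
    using eigenvalue_one_minus_iff[OF c(3), of "1 - \<tau>"] \<tau>(1) by simp
  then obtain \<nu> where \<nu>: "eigenvalue M \<nu>" "cmod (1 - \<tau> - \<nu>) \<le> cond_number p V * mat_pnorm p E"
    using bauer_fike[OF p M E V] by blast
  have "cmod (1 - \<nu>) \<le> spectral_radius (1\<^sub>m n - M)"
    by (rule cmod_eigenvalue_le_spectral_radius[OF c(2)])
      (simp add: eigenvalue_one_minus_iff[OF M] \<nu>(1))
  moreover have "cmod \<tau> \<le> cmod (1 - \<nu>) + cmod (1 - \<tau> - \<nu>)"
    using norm_triangle_ineq4[of "1 - \<nu>" "1 - \<tau> - \<nu>"] by simp
  ultimately show ?thesis using \<nu>(2) \<tau>(2) by linarith
qed

section \<open>Powers of matrices of spectral radius below one\<close>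

lemma pow_mat_smult:
  fixes A :: "'a :: comm_semiring_1 mat"
  assumes A: "A \<in> carrier_mat n n"
  shows "(c \<cdot>\<^sub>m A) ^\<^sub>m k = c ^ k \<cdot>\<^sub>m (A ^\<^sub>m k)"
proof (induction k)
  case 0
  show ?case using A by (auto intro!: eq_matI)
next
  case (Suc k)
  have Ak: "A ^\<^sub>m k \<in> carrier_mat n n" using A by simp
  have "(c \<cdot>\<^sub>m A) ^\<^sub>m Suc k = (c ^ k \<cdot>\<^sub>m (A ^\<^sub>m k)) * (c \<cdot>\<^sub>m A)" using Suc by simp
  also have "\<dots> = c ^ k \<cdot>\<^sub>m (c \<cdot>\<^sub>m (A ^\<^sub>m k * A))"
    using mult_smult_assoc_mat[OF Ak smult_carrier_mat[OF A]] mult_smult_distrib[OF Ak A] by simp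
  finally show ?case using A by (auto intro!: eq_matI simp: mult.assoc mult.left_commute)
qed

text \<open>
  Spectral radius below \<open>1\<close> yields bounded powers. Applied to \<open>A / s\<close> with \<open>\<rho>(A) < s < 1\<close>, this
  bounds the powers of \<open>A\<close> itself by a multiple of \<open>s ^ k\<close>.
\<close>

lemma pow_mat_tendsto_0:
  fixes A :: "complex mat"
  assumes A: "A \<in> carrier_mat n n" and sr: "spectral_radius A < 1" and ij: "i < n" "j < n"
  shows "(\<lambda>k. (A ^\<^sub>m k) $$ (i, j)) \<longlonglongrightarrow> 0"
proof -
  have n: "0 < n" using ij by simp
  have sr0: "0 \<le> spectral_radius A" using spectral_radius_attained[OF A n] norm_ge_zero by metis
  define s where "s = (spectral_radius A + 1) / 2"
  have s: "0 < s" "s < 1" "spectral_radius A < s" unfolding s_def using sr sr0 by auto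
  define A' where "A' = complex_of_real (1 / s) \<cdot>\<^sub>m A"
  have A': "A' \<in> carrier_mat n n" unfolding A'_def using A by simp
  have AA': "A = complex_of_real s \<cdot>\<^sub>m A'" unfolding A'_def using s by (auto intro!: eq_matI)
  obtain \<mu> where \<mu>: "eigenvalue A' \<mu>" "spectral_radius A' = cmod \<mu>"
    using spectral_radius_attained[OF A' n] .
  have "eigenvalue A (complex_of_real s * \<mu>)"
  proof -
    from \<mu>(1) obtain v where v: "v \<in> carrier_vec n" "v \<noteq> 0\<^sub>v n" "A' *\<^sub>v v = \<mu> \<cdot>\<^sub>v v"
      unfolding eigenvalue_def eigenvector_def using A' by auto
    have "A *\<^sub>v v = complex_of_real s \<cdot>\<^sub>v (A' *\<^sub>v v)"
      unfolding AA' using A' v(1) by (intro eq_vecI) auto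
    hence "A *\<^sub>v v = (complex_of_real s * \<mu>) \<cdot>\<^sub>v v" unfolding v(3) by (simp add: smult_smult_assoc)
    thus ?thesis using v A unfolding eigenvalue_def eigenvector_def by auto
  qed
  from cmod_eigenvalue_le_spectral_radius[OF A this] have "s * cmod \<mu> \<le> spectral_radius A"
    using s by (simp add: norm_mult)
  hence "s * cmod \<mu> < s" using s(3) by linarith
  hence "spectral_radius A' < 1" unfolding \<mu>(2) using s(1) by simp
  then obtain C where C: "\<And>k. norm_bound (A' ^\<^sub>m k) C"
    using spectral_radius_jnf_norm_bound_less_1_upper_triangular[OF A'] by blast
  have bound: "cmod ((A ^\<^sub>m k) $$ (i, j)) \<le> s ^ k * C" for k
  proof -
    have "(A ^\<^sub>m k) $$ (i, j) = complex_of_real s ^ k * (A' ^\<^sub>m k) $$ (i, j)"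
      unfolding AA' pow_mat_smult[OF A'] using ij A' by simp
    moreover have "cmod ((A' ^\<^sub>m k) $$ (i, j)) \<le> C"
      using C[of k] ij A' unfolding norm_bound_def by simp
    ultimately show ?thesis using s by (simp add: norm_mult norm_power mult_left_mono)
  qed
  have "(\<lambda>k. s ^ k) \<longlonglongrightarrow> 0" using s by (intro LIMSEQ_realpow_zero) auto
  thus ?thesis by (rule tendsto_0_le[where K = C]) (use bound s in auto)
qed

lemma linear_recurrence_eq_pow_mat:
  fixes A :: "'a :: comm_semiring_1 mat"
  assumes A: "A \<in> carrier_mat n n" and e: "e 0 \<in> carrier_vec n" "\<And>k. e (Suc k) = A *\<^sub>v e k"
  shows "e k = A ^\<^sub>m k *\<^sub>v e 0"
  using e
proof (induction k arbitrary: e)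
  case 0
  thus ?case using A by simp
next
  case (Suc k)
  \<comment> \<open>Matrix powers grow on the right, so the shifted sequence absorbs the first step.\<close>
  have "e (Suc k) = A ^\<^sub>m k *\<^sub>v e (Suc 0)"
    using Suc.IH[of "\<lambda>i. e (Suc i)"] Suc.prems A by simp
  also have "\<dots> = A ^\<^sub>m k *\<^sub>v (A *\<^sub>v e 0)" using Suc.prems by simp
  also have "\<dots> = (A ^\<^sub>m k * A) *\<^sub>v e 0"
    using assoc_mult_mat_vec[OF pow_carrier_mat[OF A] A Suc.prems(1)] by simp
  finally show ?case by simp
qed

text \<open>The errors \<open>l - x k\<close> satisfy the homogeneous recurrence with matrix \<open>Id - N\<close>.\<close>

lemma stationary_iteration_converges:
  assumes N: "N \<in> carrier_mat n n" and sr: "spectral_radius (1\<^sub>m n - N) < 1"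
    and l: "l \<in> carrier_vec n" and x0: "x 0 \<in> carrier_vec n"
    and step: "\<And>k. x (Suc k) = x k + N *\<^sub>v (l - x k)"
  shows "vec_tendsto n x l"
proof -
  define A where "A = 1\<^sub>m n - N"
  have A: "A \<in> carrier_mat n n" unfolding A_def using N by auto
  have x: "x k \<in> carrier_vec n" for k
    using x0 N l by (induction k) (auto simp: step intro!: add_carrier_vec)
  define e where "e k = l - x k" for k
  have e: "e k \<in> carrier_vec n" for k unfolding e_def using x l by auto
  have rec: "e (Suc k) = A *\<^sub>v e k" for k
  proof -
    have "A *\<^sub>v e k = e k - N *\<^sub>v e k"
      unfolding A_def using minus_mult_distrib_mat_vec[OF one_carrier_mat N e] e by simp
    thus ?thesis using l x[of k] N unfolding e_def step by (intro eq_vecI) auto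
  qed
  have pow: "e k = A ^\<^sub>m k *\<^sub>v e 0" for k
    by (rule linear_recurrence_eq_pow_mat[where e = e, OF A e rec])
  have "(\<lambda>k. x k $ i) \<longlonglongrightarrow> l $ i" if i: "i < n" for i
  proof -
    have ei: "e k $ i = (\<Sum>j<n. (A ^\<^sub>m k) $$ (i, j) * e 0 $ j)" for k
      unfolding pow[of k] using i A e[of 0] by (simp add: scalar_prod_def atLeast0LessThan)
    have "(\<lambda>k. \<Sum>j<n. (A ^\<^sub>m k) $$ (i, j) * e 0 $ j) \<longlonglongrightarrow> (\<Sum>j<n. 0 * e 0 $ j)"
      by (intro tendsto_sum tendsto_mult_right pow_mat_tendsto_0[OF A sr[folded A_def] i]) auto
    hence "(\<lambda>k. e k $ i) \<longlonglongrightarrow> 0" unfolding ei by simp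
    from tendsto_diff[OF tendsto_const[of "l $ i"] this] show ?thesis
      unfolding e_def using i carrier_vecD[OF l] carrier_vecD[OF x] by simp
  qed
  thus ?thesis unfolding vec_tendsto_def using x l by blast
qed

section \<open>Convergence of the perturbed iteration\<close>

theorem corollary1:
  fixes n :: nat
    and A P :: "real mat" and b xinf :: "real vec"
    and Z :: "complex vec set"
    and Q\<^sub>R B N\<^sub>T \<delta>N N V :: "complex mat"
    and p :: ereal and lam \<delta> :: real
  defines "PA \<equiv> map_mat complex_of_real (inv_mat P * A)"
  assumes "0 < n"
    and "A \<in> carrier_mat n n" and "invertible_mat A"
    and "P \<in> carrier_mat n n" and "invertible_mat P"
    and "b \<in> carrier_vec n" and "xinf \<in> carrier_vec n" and "A *\<^sub>v xinf = b"
    and "invariant_subspace n PA Z"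
    and "projection_onto n Q\<^sub>R Z"
    and "B \<in> carrier_mat n n" and "invertible_mat B"
    and "N\<^sub>T = mat_in_basis B (Q\<^sub>R + PA * (1\<^sub>m n - Q\<^sub>R))"
    and "\<delta>N \<in> carrier_mat n n"
    and "N = N\<^sub>T + \<delta>N"
    and "diagonalizable_mat N\<^sub>T"
    and "eigenvector_matrix N\<^sub>T V"
    and "lam = spectral_radius (1\<^sub>m n - N\<^sub>T)"
    and "0 < \<delta>" and "lam < 1 - \<delta>"
    and "1 \<le> p"
    and "cond_number p V * mat_pnorm p \<delta>N < \<delta>"
  shows "(\<forall>x :: nat \<Rightarrow> complex vec.
            x 0 \<in> carrier_vec n \<longrightarrow>
            (\<forall>k. x (Suc k) =
               x k + N *\<^sub>v (vec_in_basis B (map_vec complex_of_real xinf) - x k)) \<longrightarrow>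
            vec_tendsto n x (vec_in_basis B (map_vec complex_of_real xinf)))
         \<and> spectral_radius (1\<^sub>m n - N) < 1 - \<delta> + cond_number p V * mat_pnorm p \<delta>N"
proof -
  have B: "B \<in> carrier_mat n n" and Bi: "inv_mat B \<in> carrier_mat n n"
    using \<open>B \<in> carrier_mat n n\<close> inv_mat_inverse(1)[OF _ \<open>invertible_mat B\<close>] by auto
  have NT: "N\<^sub>T \<in> carrier_mat n n"
    unfolding \<open>N\<^sub>T = _\<close> mat_in_basis_def using B Bi by auto
  have N: "N \<in> carrier_mat n n" using \<open>N = N\<^sub>T + \<delta>N\<close> NT \<open>\<delta>N \<in> carrier_mat n n\<close> by simp
  have "spectral_radius (1\<^sub>m n - N) \<le> lam + cond_number p V * mat_pnorm p \<delta>N"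
    using spectral_radius_one_minus_perturbed_le[OF \<open>1 \<le> p\<close> \<open>0 < n\<close> NT
        \<open>\<delta>N \<in> carrier_mat n n\<close> \<open>eigenvector_matrix N\<^sub>T V\<close>]
    unfolding \<open>N = N\<^sub>T + \<delta>N\<close> \<open>lam = _\<close> .
  hence bound: "spectral_radius (1\<^sub>m n - N) < 1 - \<delta> + cond_number p V * mat_pnorm p \<delta>N"
    using \<open>lam < 1 - \<delta>\<close> by linarith
  hence sr: "spectral_radius (1\<^sub>m n - N) < 1"
    using \<open>cond_number p V * mat_pnorm p \<delta>N < \<delta>\<close> by linarith
  have l: "vec_in_basis B (map_vec complex_of_real xinf) \<in> carrier_vec n"
    unfolding vec_in_basis_def using Bi by (auto intro!: carrier_vecI)
  show ?thesis using stationary_iteration_converges[OF N sr l] bound by blast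
qed

end
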